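(* The monoid $\mathsf{pfl}\mathcal{RM}^{\mathsf{fin}}_2$ has a generating set of the form $\Gamma\cup\tau$, where $\Gamma$ is a finite subset of $\mathsf{pfl}\mathcal{RM}^{\mathsf{fin}}_2$. One can choose $\Gamma=\{\zeta_1,\text{not},\text{and},\text{or},\text{fork}\}$; so this is a complete set of gates for acyclic partial circuits.
   Context: Strings are over $\{0,1\}$. A prefix code is a set of strings none of which is a proper prefix of another. A right ideal of $\{0,1\}^*$ is a set $R$ with $R=R\{0,1\}^*$; it equals $P\{0,1\}^*$ for a unique prefix code $P$. A right-ideal morphism is a partial function $f:\{0,1\}^*\to\{0,1\}^*$ whose domain is a right ideal and such that $f(xu)=f(x)u$ for all $x\in\mathrm{Dom}(f)$, $u\in\{0,1\}^*$; $\mathrm{domC}(f)$ and $\mathrm{imC}(f)$ are the prefix codes of $\mathrm{Dom}(f)$ and $\mathrm{Im}(f)$. $\mathsf{pfl}\mathcal{RM}^{\mathsf{fin}}_2$ is the monoid (under composition) of right-ideal morphisms $f$ such that $\mathrm{domC}(f)\subseteq\{0,1\}^m$ for some $m\ge0$, and $|x_1|=|x_2|$ implies $|f(x_1)|=|f(x_2)|$ for all $x_1,x_2\in\mathrm{Dom}(f)$; then $f(\mathrm{domC}(f))=\mathrm{imC}(f)\subseteq\{0,1\}^n$ for some $n\ge0$ ($m,n$ depend on $f$; the empty function is included). $\tau=\{\tau_{i,j}:1\le i<j\}$, where $\tau_{i,j}$ is the right-ideal morphism with domain code $\{0,1\}^j$ exchanging the bits at positions $i$ and $j$. The gates, as right-ideal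 morphisms: $\text{not}(x_1v)=\overline{x_1}v$; $\text{and}(x_1x_2v)=(x_1\wedge x_2)v$; $\text{or}(x_1x_2v)=(x_1\vee x_2)v$; $\text{fork}(x_1v)=x_1x_1v$ ($x_i\in\{0,1\}$, $v\in\{0,1\}^*$). The partial gate $\zeta_1$ is the right-ideal morphism with domain code $\{00,01\}$ and image code $\{0,1\}$ given by $\zeta_1(00)=0$, $\zeta_1(01)=1$ (undefined on strings starting with $1$). A partial circuit is an acyclic circuit in which, besides not, and, or, fork, finitely many kinds of partial gates from $\mathsf{pfl}\mathcal{RM}^{\mathsf{fin}}_2$ may be used; if some gate has undefined output on a given input then the whole output is undefined for that input. "Complete set of gates" means that, together with $\tau$, these gates generate $\mathsf{pfl}\mathcal{RM}^{\mathsf{fin}}_2$.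
   Formalization: With m=0 or n=0 allowed, the five gates and τ do not generate the monoid (v↦0v is not a product); it is proved instead that they generate exactly the identity and all elements with m,n≥1, while a larger finite Γ generates the whole monoid. *)

theory Defs
  imports "HOL-Algebra.Group" "HOL-Library.Sublist"
begin

text \<open>Bits are booleans (\<^const>\<open>True\<close> is 1), strings are bit lists, and partial functions on strings
  are maps, composed by \<^const>\<open>map_comp\<close>.\<close>

type_synonym str = "bool list"

definition prefix_code :: "str set \<Rightarrow> bool" where
  "prefix_code P \<longleftrightarrow> (\<forall>x\<in>P. \<forall>y\<in>P. \<not> strict_prefix x y)"

definition extensions :: "str set \<Rightarrow> str set" where
  "extensions P = {p @ u |p u. p \<in> P}"

definition right_ideal :: "str set \<Rightarrow> bool" where
  "right_ideal R \<longleftrightarrow> R = extensions R"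

definition ideal_code :: "str set \<Rightarrow> str set" where
  "ideal_code R = (THE P. prefix_code P \<and> R = extensions P)"

definition right_ideal_morphism :: "(str \<rightharpoonup> str) \<Rightarrow> bool" where
  "right_ideal_morphism f \<longleftrightarrow>
     right_ideal (dom f) \<and> (\<forall>x\<in>dom f. \<forall>u. f (x @ u) = Some (the (f x) @ u))"

definition domC :: "(str \<rightharpoonup> str) \<Rightarrow> str set" where
  "domC f = ideal_code (dom f)"

definition imC :: "(str \<rightharpoonup> str) \<Rightarrow> str set" where
  "imC f = ideal_code (ran f)"

definition pflRM :: "(str \<rightharpoonup> str) set" where
  "pflRM = {f. right_ideal_morphism f \<and>
               (\<exists>m. domC f \<subseteq> {w. length w = m}) \<and>
               (\<forall>x1\<in>dom f. \<forall>x2\<in>dom f.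
                  length x1 = length x2 \<longrightarrow> length (the (f x1)) = length (the (f x2)))}"

definition pflRM_monoid :: "(str \<rightharpoonup> str) monoid" where
  "pflRM_monoid = \<lparr>carrier = pflRM, mult = (\<circ>\<^sub>m), one = Some\<rparr>"

inductive_set generate_monoid :: "('a, 'b) monoid_scheme \<Rightarrow> 'a set \<Rightarrow> 'a set"
  for G and S where
    one: "\<one>\<^bsub>G\<^esub> \<in> generate_monoid G S"
  | incl: "s \<in> S \<Longrightarrow> s \<in> generate_monoid G S"
  | mult: "a \<in> generate_monoid G S \<Longrightarrow> b \<in> generate_monoid G S \<Longrightarrow> a \<otimes>\<^bsub>G\<^esub> b \<in> generate_monoid G S"

text \<open>Positions are counted from 1 in \<open>tau i j\<close> but from 0 in lists.\<close>

definition tau :: "nat \<Rightarrow> nat \<Rightarrow> str \<rightharpoonup> str" where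
  "tau i j x = (if j \<le> length x then Some (x[i - 1 := x ! (j - 1), j - 1 := x ! (i - 1)]) else None)"

definition taus :: "(str \<rightharpoonup> str) set" where
  "taus = {tau i j |i j. 1 \<le> i \<and> i < j}"

fun not_gate :: "str \<rightharpoonup> str" where
  "not_gate (x # v) = Some ((\<not> x) # v)"
| "not_gate _ = None"

fun and_gate :: "str \<rightharpoonup> str" where
  "and_gate (x # y # v) = Some ((x \<and> y) # v)"
| "and_gate _ = None"

fun or_gate :: "str \<rightharpoonup> str" where
  "or_gate (x # y # v) = Some ((x \<or> y) # v)"
| "or_gate _ = None"

fun fork_gate :: "str \<rightharpoonup> str" where
  "fork_gate (x # v) = Some (x # x # v)"
| "fork_gate _ = None"

fun zeta1 :: "str \<rightharpoonup> str" where
  "zeta1 (False # y # v) = Some (y # v)"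
| "zeta1 _ = None"

definition circuit_gates :: "(str \<rightharpoonup> str) set" where
  "circuit_gates = {zeta1, not_gate, and_gate, or_gate, fork_gate}"

text \<open>The members of \<^const>\<open>pflRM\<close> whose domain code and image code lie in \<open>{0,1}\<^sup>m\<close> and \<open>{0,1}\<^sup>n\<close>
  with \<open>m, n \<ge> 1\<close>, i.e. the input-output functions of circuits with at least one input wire and at
  least one output wire; the empty function is one of them. The monoid \<^const>\<open>pflRM\<close> itself allows
  \<open>m = 0\<close> and \<open>n = 0\<close>, and such functions (e.g. \<open>v \<mapsto> 0v\<close> and \<open>x\<^sub>1v \<mapsto> v\<close>) are, apart from the identity,
  not products of the gates and bit transpositions: see \<open>circuit_gates_not_generating\<close> below.\<close>

definition circuit_functions :: "(str \<rightharpoonup> str) set" where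
  "circuit_functions = {f \<in> pflRM. (\<exists>m\<ge>1. domC f \<subseteq> {w. length w = m}) \<and>
                                   (\<exists>n\<ge>1. imC f \<subseteq> {w. length w = n})}"

lemma extensions_code_minimal:
  assumes "prefix_code P"
  shows "P = {x \<in> extensions P. \<forall>y\<in>extensions P. \<not> strict_prefix y x}"
proof (intro equalityI subsetI)
  fix x assume x: "x \<in> P"
  have "\<not> strict_prefix y x" if y: "y \<in> extensions P" for y
  proof
    assume yx: "strict_prefix y x"
    obtain p u where "p \<in> P" "y = p @ u"
      using y unfolding extensions_def by blast
    then have "strict_prefix p x"
      using yx by (metis prefixI prefix_order.le_less_trans)
    then show False using assms x \<open>p \<in> P\<close> by (auto simp: prefix_code_def)
  qed
  moreover have "x \<in> extensions P" using x by (force simp: extensions_def)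
  ultimately show "x \<in> {x \<in> extensions P. \<forall>y\<in>extensions P. \<not> strict_prefix y x}" by blast
next
  fix x assume "x \<in> {x \<in> extensions P. \<forall>y\<in>extensions P. \<not> strict_prefix y x}"
  then obtain p u where p: "p \<in> P" "x = p @ u" and min: "\<forall>y\<in>extensions P. \<not> strict_prefix y x"
    unfolding extensions_def by blast
  have "p \<in> extensions P" using p by (force simp: extensions_def)
  then have "p = x" using min p by (auto simp: strict_prefix_def)
  then show "x \<in> P" using p by simp
qed

lemma ideal_code_ex1:
  assumes "right_ideal R"
  shows "\<exists>!P. prefix_code P \<and> R = extensions P"
proof -
  let ?P = "{x \<in> R. \<forall>y\<in>R. \<not> strict_prefix y x}"
  have "\<exists>p\<in>?P. prefix p x" if "x \<in> R" for x
    using that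
  proof (induction x rule: length_induct)
    case (1 x)
    show ?case
    proof (cases "x \<in> ?P")
      case False
      then obtain y where "y \<in> R" "strict_prefix y x" using 1 by blast
      then show ?thesis using 1 prefix_length_less by (meson prefix_order.less_imp_le prefix_order.trans)
    qed auto
  qed
  then have "R \<subseteq> extensions ?P" unfolding extensions_def prefix_def by blast
  moreover have "extensions ?P \<subseteq> extensions R" by (auto simp: extensions_def)
  ultimately have "R = extensions ?P" using assms by (auto simp: right_ideal_def)
  moreover have "prefix_code ?P" by (auto simp: prefix_code_def)
  moreover have "P = ?P" if "prefix_code P \<and> R = extensions P" for P
    using extensions_code_minimal[of P] that by simp
  ultimately show ?thesis by (intro ex1I[of _ ?P]) simp_all
qed

lemma ideal_code_subset_length_iff:
  assumes "right_ideal R"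
  shows "ideal_code R \<subseteq> {w. length w = m} \<longleftrightarrow> (\<forall>w\<in>R. m \<le> length w \<and> take m w \<in> R)"
proof -
  have *: "prefix_code (ideal_code R)" "R = extensions (ideal_code R)"
    using theI'[OF ideal_code_ex1[OF assms]] by (auto simp: ideal_code_def)
  have min: "ideal_code R = {x \<in> R. \<forall>y\<in>R. \<not> strict_prefix y x}"
    using extensions_code_minimal[OF *(1)] *(2) by simp
  show ?thesis
  proof (intro iffI ballI subsetI)
    fix w assume sub: "ideal_code R \<subseteq> {w. length w = m}" and "w \<in> R"
    then obtain p u where p: "p \<in> ideal_code R" "w = p @ u" using *(2) unfolding extensions_def by blast
    then have "length p = m" "p \<in> R" using sub min by auto
    then show "m \<le> length w \<and> take m w \<in> R" using p by simp
  next
    fix w assume R: "\<forall>w\<in>R. m \<le> length w \<and> take m w \<in> R" and "w \<in> ideal_code R"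
    then have "w \<in> R" "\<forall>y\<in>R. \<not> strict_prefix y w" using min by auto
    then have "take m w = w" using R take_is_prefix by (metis strict_prefix_def)
    then have "length w \<le> m" by (metis length_take min.cobounded2)
    then show "w \<in> {w. length w = m}" using R \<open>w \<in> R\<close> by (auto intro: le_antisym)
  qed
qed

lemma pflRM_iff:
  "f \<in> pflRM \<longleftrightarrow>
     (\<forall>x y u. f x = Some y \<longrightarrow> f (x @ u) = Some (y @ u)) \<and>
     (\<exists>m. \<forall>x\<in>dom f. m \<le> length x \<and> take m x \<in> dom f) \<and>
     (\<forall>x1 x2 y1 y2. f x1 = Some y1 \<longrightarrow> f x2 = Some y2 \<longrightarrow> length x1 = length x2
        \<longrightarrow> length y1 = length y2)"
proof -
  have rim: "right_ideal_morphism f \<longleftrightarrow> (\<forall>x y u. f x = Some y \<longrightarrow> f (x @ u) = Some (y @ u))"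
  proof
    assume R: "\<forall>x y u. f x = Some y \<longrightarrow> f (x @ u) = Some (y @ u)"
    have "dom f = extensions (dom f)"
    proof (intro equalityI subsetI)
      fix x assume "x \<in> dom f"
      then have "x = x @ [] \<and> x \<in> dom f" by simp
      then show "x \<in> extensions (dom f)" unfolding extensions_def by blast
    next
      fix x assume "x \<in> extensions (dom f)"
      then obtain p u y where "x = p @ u" "f p = Some y" unfolding extensions_def by blast
      then show "x \<in> dom f" using R by auto
    qed
    moreover have "\<forall>x\<in>dom f. \<forall>u. f (x @ u) = Some (the (f x) @ u)" using R by auto
    ultimately show "right_ideal_morphism f"
      unfolding right_ideal_morphism_def right_ideal_def by blast
  next
    assume M: "right_ideal_morphism f"
    show "\<forall>x y u. f x = Some y \<longrightarrow> f (x @ u) = Some (y @ u)"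
    proof (intro allI impI)
      fix x y u assume "f x = Some y"
      moreover from this have "f (x @ u) = Some (the (f x) @ u)"
        using M unfolding right_ideal_morphism_def by blast
      ultimately show "f (x @ u) = Some (y @ u)" by simp
    qed
  qed
  show ?thesis
  proof (cases "right_ideal_morphism f")
    case True
    then have "right_ideal (dom f)" by (simp add: right_ideal_morphism_def)
    then have A: "(\<exists>m. domC f \<subseteq> {w. length w = m}) \<longleftrightarrow>
        (\<exists>m. \<forall>x\<in>dom f. m \<le> length x \<and> take m x \<in> dom f)"
      unfolding domC_def using ideal_code_subset_length_iff by simp
    have B: "(\<forall>x1\<in>dom f. \<forall>x2\<in>dom f.
           length x1 = length x2 \<longrightarrow> length (the (f x1)) = length (the (f x2))) \<longleftrightarrow>
        (\<forall>x1 x2 y1 y2. f x1 = Some y1 \<longrightarrow> f x2 = Some y2 \<longrightarrow> length x1 = length x2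
           \<longrightarrow> length y1 = length y2)"
      (is "?L \<longleftrightarrow> ?R")
    proof
      assume L: ?L
      show ?R
      proof (intro allI impI)
        fix x1 x2 y1 y2
        assume a: "f x1 = Some y1" "f x2 = Some y2" "length x1 = length x2"
        then have "length (the (f x1)) = length (the (f x2))" using L by blast
        then show "length y1 = length y2" using a by simp
      qed
    next
      assume R: ?R
      show ?L
      proof (intro ballI impI)
        fix x1 x2 assume "x1 \<in> dom f" "x2 \<in> dom f" and l: "length x1 = length x2"
        then obtain y1 y2 where y: "f x1 = Some y1" "f x2 = Some y2" by blast
        then have "length y1 = length y2" using R l by blast
        then show "length (the (f x1)) = length (the (f x2))" using y by simp
      qed
    qed
    show ?thesis unfolding pflRM_def mem_Collect_eq A B rim by (rule refl)
  next
    case False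
    then show ?thesis unfolding pflRM_def mem_Collect_eq rim[symmetric] by simp
  qed
qed

lemma pflRM_comp:
  assumes "f \<in> pflRM" "g \<in> pflRM"
  shows "g \<circ>\<^sub>m f \<in> pflRM"
proof -
  have ext_f: "f x = Some y \<Longrightarrow> f (x @ u) = Some (y @ u)" for x y u
    using assms(1) by (simp add: pflRM_iff)
  have ext_g: "g x = Some y \<Longrightarrow> g (x @ u) = Some (y @ u)" for x y u
    using assms(2) by (simp add: pflRM_iff)
  obtain m where m: "\<And>x. x \<in> dom f \<Longrightarrow> m \<le> length x \<and> take m x \<in> dom f"
    using assms(1) unfolding pflRM_iff by blast
  obtain p where p: "\<And>x. x \<in> dom g \<Longrightarrow> p \<le> length x \<and> take p x \<in> dom g"
    using assms(2) unfolding pflRM_iff by blast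
  have len_f: "length y1 = length y2"
    if "f x1 = Some y1" "f x2 = Some y2" "length x1 = length x2" for x1 x2 y1 y2
    using that assms(1) unfolding pflRM_iff by blast
  have len_g: "length y1 = length y2"
    if "g x1 = Some y1" "g x2 = Some y2" "length x1 = length x2" for x1 x2 y1 y2
    using that assms(2) unfolding pflRM_iff by blast
  have "\<exists>n. \<forall>x y. f x = Some y \<longrightarrow> length y + m = length x + n"
  proof (cases "dom f = {}")
    case False
    then obtain x0 where "x0 \<in> dom f" by blast
    then obtain y0 where y0: "f (take m x0) = Some y0" and l0: "length (take m x0) = m"
      using m[of x0] by auto
    have "length y + m = length x + length y0" if fx: "f x = Some y" for x y
    proof -
      obtain z where z: "f (take m x) = Some z" and l: "m \<le> length x" using fx m[of x] by auto
      have "f x = Some (z @ drop m x)" using ext_f[OF z, of "drop m x"] by simp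
      moreover have "length z = length y0" using len_f[OF z y0] l l0 by simp
      ultimately show ?thesis using fx l by auto
    qed
    then show ?thesis by blast
  qed auto
  then obtain n where n: "\<And>x y. f x = Some y \<Longrightarrow> length y + m = length x + n" by blast
  have "m + (p - n) \<le> length w \<and> take (m + (p - n)) w \<in> dom (g \<circ>\<^sub>m f)"
    if w: "w \<in> dom (g \<circ>\<^sub>m f)" for w
  proof -
    let ?M = "m + (p - n)"
    obtain v where "(g \<circ>\<^sub>m f) w = Some v" using w by blast
    then obtain y where y: "f w = Some y" "y \<in> dom g" unfolding map_comp_Some_iff by blast
    have "w \<in> dom f" using y(1) by blast
    then have mw: "m \<le> length w" "take m w \<in> dom f" using m by auto
    then have le: "?M \<le> length w" using n[OF y(1)] p[OF y(2)] by linarith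
    have tk: "take ?M w = take m w @ take (p - n) (drop m w)" by (simp add: take_add)
    obtain z0 where "f (take m w) = Some z0" using mw(2) by blast
    from ext_f[OF this] obtain z where z: "f (take ?M w) = Some z" using tk by metis
    have yz: "y = z @ drop ?M w"
      using ext_f[OF z, of "drop ?M w"] y(1) by (simp only: append_take_drop_id option.inject)
    have lz: "p \<le> length z" using n[OF z] le by simp
    have "take p z \<in> dom g" using p[OF y(2)] yz lz by simp
    then obtain t where "g (take p z) = Some t" by blast
    from ext_g[OF this, of "drop p z"] have "z \<in> dom g" by auto
    then show ?thesis using le z by (auto simp: map_comp_Some_iff)
  qed
  moreover have "(g \<circ>\<^sub>m f) (x @ u) = Some (y @ u)" if "(g \<circ>\<^sub>m f) x = Some y" for x y u
    using that ext_f ext_g by (auto simp: map_comp_Some_iff)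
  moreover have "length y1 = length y2"
    if "(g \<circ>\<^sub>m f) x1 = Some y1" "(g \<circ>\<^sub>m f) x2 = Some y2" "length x1 = length x2" for x1 x2 y1 y2
    using that len_f len_g unfolding map_comp_Some_iff by blast
  ultimately show ?thesis unfolding pflRM_iff by blast
qed

lemma monoid_pflRM: "monoid pflRM_monoid"
proof (rule monoidI)
  show "\<one>\<^bsub>pflRM_monoid\<^esub> \<in> carrier pflRM_monoid"
    by (auto simp: pflRM_monoid_def pflRM_iff dom_def)
  show "x \<otimes>\<^bsub>pflRM_monoid\<^esub> y \<in> carrier pflRM_monoid"
    if "x \<in> carrier pflRM_monoid" "y \<in> carrier pflRM_monoid" for x y
    using that by (simp add: pflRM_monoid_def pflRM_comp)
qed (auto simp: pflRM_monoid_def map_comp_def fun_eq_iff split: option.splits)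

lemma generate_circuit_gates_nil:
  assumes "f \<in> generate_monoid pflRM_monoid (circuit_gates \<union> taus)"
  shows "f = Some \<or> ([] \<notin> dom f \<and> [] \<notin> ran f)"
  using assms
proof induction
  case one
  then show ?case by (simp add: pflRM_monoid_def)
next
  case (incl f)
  have 1: "f [] = None" using incl by (auto simp: circuit_gates_def taus_def tau_def)
  have "f x \<noteq> Some []" for x
    using incl
    by (auto simp: circuit_gates_def taus_def tau_def split: if_splits
             elim: not_gate.elims and_gate.elims or_gate.elims fork_gate.elims zeta1.elims)
  then show ?case using 1 by (auto simp: ran_def)
next
  case (mult a b)
  then show ?case
    by (auto simp: pflRM_monoid_def map_comp_Some_iff ran_def dom_def)
qed

lemma circuit_gates_not_generating:
  "generate_monoid pflRM_monoid (circuit_gates \<union> taus) \<noteq> carrier pflRM_monoid"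
proof -
  let ?f = "\<lambda>v. Some (False # v)"
  have "?f \<in> carrier pflRM_monoid" by (auto simp: pflRM_monoid_def pflRM_iff)
  moreover have "?f \<noteq> Some" "[] \<in> dom ?f" by (auto simp: fun_eq_iff)
  ultimately show ?thesis using generate_circuit_gates_nil by blast
qed

end

theory Submission
  imports Defs
begin

text \<open>A nonempty member of \<^const>\<open>pflRM\<close> rewrites a prefix of a fixed length \<open>m\<close> into a prefix of a fixed
  length \<open>n\<close> and leaves the rest of the string alone. A member is a circuit function exactly if it is
  undefined on the empty string and never outputs it (\<open>circuit_functions_iff\<close>). All gates and bit
  transpositions have this property and it survives composition, so nothing else is generated, apart
  from the identity.

  Conversely, a partial function \<open>f\<close> with \<open>m, n \<ge> 1\<close> is computed on a tape in three stages.
  \<^item> A Boolean function of the input is evaluated and its value put in front of the tape, with the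
    input still there (\<open>computable_of_take\<close>, by Shannon expansion). Repeating this turns \<open>x v\<close> into
    \<open>T(x) x v\<close> for an arbitrary total \<open>T\<close>; the only care needed is that the input moves to the right
    while the answer grows, and therefore \<open>computable\<close> quantifies over the displacement.
  \<^item> The copy of \<open>x\<close> is deleted bit by bit. A bit \<open>z\<close> next to a bit \<open>y\<close> disappears through the
    absorption law \<open>y \<and> (y \<or> z) = y\<close>. This needs a bit that survives, which is where \<open>n \<ge> 1\<close> enters.
  \<^item> With \<open>T(x) = 0 f(x)\<close> where \<open>f(x)\<close> is defined and \<open>T(x)\<close> starting with 1 elsewhere, a single
    \<^const>\<open>zeta1\<close> removes the leading bit and makes the result undefined where it must be.

  Every composition below must also have exactly the right domain: no step may read bits beyond the
  \<open>m\<close> input bits and those produced so far.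

  For the finite generating set of the whole monoid, the two partial operations \<open>v \<mapsto> 0v\<close> and
  \<open>x\<^sub>1v \<mapsto> v\<close> are added to the gates. If \<open>g\<close> maps \<open>b v\<close> to \<open>0 f(v)\<close>, then \<open>g\<close> is a circuit function
  for every \<open>f\<close> in the monoid, and \<open>f\<close> is \<open>g\<close> preceded by the former operation and followed by the
  latter.\<close>

section \<open>The shape of the elements of the monoid\<close>

lemma pflRMI:
  assumes "\<And>x y u. f x = Some y \<Longrightarrow> f (x @ u) = Some (y @ u)"
    and "\<And>x y. f x = Some y \<Longrightarrow> m \<le> length x \<and> f (take m x) \<noteq> None"
    and "\<And>x y. f x = Some y \<Longrightarrow> length y + m = length x + n"
  shows "f \<in> pflRM"
  unfolding pflRM_iff
proof (intro conjI)
  show "\<forall>x y u. f x = Some y \<longrightarrow> f (x @ u) = Some (y @ u)" using assms(1) by blast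
  show "\<exists>m. \<forall>x\<in>dom f. m \<le> length x \<and> take m x \<in> dom f"
    using assms(2) by (intro exI[of _ m]) (auto simp: dom_def)
  show "\<forall>x1 x2 y1 y2. f x1 = Some y1 \<longrightarrow> f x2 = Some y2 \<longrightarrow> length x1 = length x2
      \<longrightarrow> length y1 = length y2"
    using assms(3) by (metis add_right_cancel)
qed

lemma pflRM_extend: "f \<in> pflRM \<Longrightarrow> f x = Some y \<Longrightarrow> f (x @ u) = Some (y @ u)"
  by (simp add: pflRM_iff)

lemma pflRM_prefix_rewriting:
  assumes f: "f \<in> pflRM" and ne: "f \<noteq> Map.empty"
  shows "\<exists>m n. (\<forall>x y. f x = Some y \<longrightarrow> m \<le> length x \<and>
               (\<exists>z. f (take m x) = Some z \<and> length z = n \<and> y = z @ drop m x))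
           \<and> (\<exists>x y. f x = Some y \<and> length x = m \<and> length y = n)"
proof -
  obtain m where m: "\<And>x. x \<in> dom f \<Longrightarrow> m \<le> length x \<and> take m x \<in> dom f"
    using f unfolding pflRM_iff by blast
  have len: "length y1 = length y2"
    if "f x1 = Some y1" "f x2 = Some y2" "length x1 = length x2" for x1 x2 y1 y2
    using that f unfolding pflRM_iff by blast
  obtain x0 where "x0 \<in> dom f" using ne by fastforce
  then obtain y0 where y0: "f (take m x0) = Some y0" and l0: "length (take m x0) = m"
    using m[of x0] by auto
  have "m \<le> length x \<and> (\<exists>z. f (take m x) = Some z \<and> length z = length y0 \<and> y = z @ drop m x)"
    if x: "f x = Some y" for x y
  proof -
    have "x \<in> dom f" using x by blast
    then obtain z where z: "f (take m x) = Some z" and mx: "m \<le> length x" using m by blast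
    have "f x = Some (z @ drop m x)" using pflRM_extend[OF f z, of "drop m x"] by simp
    moreover have "length z = length y0" using len[OF z y0] l0 mx by simp
    ultimately show ?thesis using x z mx by auto
  qed
  moreover have "\<exists>x y. f x = Some y \<and> length x = m \<and> length y = length y0" using y0 l0 by blast
  ultimately show ?thesis by blast
qed

lemma right_ideal_dom:
  assumes "f \<in> pflRM"
  shows "right_ideal (dom f)"
  using assms by (simp add: pflRM_def right_ideal_morphism_def)

lemma right_ideal_ran:
  assumes "f \<in> pflRM"
  shows "right_ideal (ran f)"
  unfolding right_ideal_def
proof (intro equalityI subsetI)
  fix w assume "w \<in> ran f"
  then have "w = w @ [] \<and> w \<in> ran f" by simp
  then show "w \<in> extensions (ran f)" unfolding extensions_def by blast
next
  fix w assume "w \<in> extensions (ran f)"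
  then obtain x y u where "w = y @ u" "f x = Some y" unfolding extensions_def ran_def by blast
  then show "w \<in> ran f" using pflRM_extend[OF assms] by (metis ranI)
qed

text \<open>The length of the domain code is zero only if the empty string lies in the domain, and
  similarly for the image code; the empty function has empty codes, which satisfy any length
  condition.\<close>

lemma circuit_functions_iff:
  "f \<in> circuit_functions \<longleftrightarrow> f \<in> pflRM \<and> [] \<notin> dom f \<and> [] \<notin> ran f"
proof
  assume "f \<in> circuit_functions"
  then obtain m n where f: "f \<in> pflRM" and mn: "m \<ge> 1" "n \<ge> 1"
    and "domC f \<subseteq> {w. length w = m}" "imC f \<subseteq> {w. length w = n}"
    unfolding circuit_functions_def by blast
  then have "\<forall>w\<in>dom f. m \<le> length w" "\<forall>w\<in>ran f. n \<le> length w"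
    unfolding domC_def imC_def
    using ideal_code_subset_length_iff[OF right_ideal_dom[OF f]]
      ideal_code_subset_length_iff[OF right_ideal_ran[OF f]] by auto
  then show "f \<in> pflRM \<and> [] \<notin> dom f \<and> [] \<notin> ran f" using f mn by force
next
  assume "f \<in> pflRM \<and> [] \<notin> dom f \<and> [] \<notin> ran f"
  then have f: "f \<in> pflRM" and nil: "[] \<notin> dom f" "[] \<notin> ran f" by auto
  have "\<exists>m\<ge>1. \<exists>n\<ge>1. (\<forall>w\<in>dom f. m \<le> length w \<and> take m w \<in> dom f)
      \<and> (\<forall>w\<in>ran f. n \<le> length w \<and> take n w \<in> ran f)"
  proof (cases "f = Map.empty")
    case True
    then show ?thesis by auto
  next
    case False
    obtain m n where
      rew: "\<And>x y. f x = Some y \<Longrightarrow>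
        m \<le> length x \<and> (\<exists>z. f (take m x) = Some z \<and> length z = n \<and> y = z @ drop m x)"
      and ex: "\<exists>x y. f x = Some y \<and> length x = m \<and> length y = n"
      using pflRM_prefix_rewriting[OF f False] by blast
    from ex obtain x0 y0 where x0: "f x0 = Some y0" "length x0 = m" "length y0 = n" by blast
    then have "x0 \<noteq> []" "y0 \<noteq> []" using nil by (auto simp: ran_def)
    then have mn: "m \<ge> 1" "n \<ge> 1" using x0 by (auto simp: Suc_le_eq)
    have "m \<le> length w \<and> take m w \<in> dom f" if "w \<in> dom f" for w
      using rew that by blast
    moreover have "n \<le> length w \<and> take n w \<in> ran f" if w: "w \<in> ran f" for w
    proof -
      obtain x where "f x = Some w" using w by (auto simp: ran_def)
      then obtain z where z: "f (take m x) = Some z" "length z = n" "w = z @ drop m x"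
        using rew by blast
      then have "take n w = z" by simp
      then show ?thesis using z by (auto intro: ranI)
    qed
    ultimately show ?thesis using mn by blast
  qed
  then show "f \<in> circuit_functions"
    using f unfolding circuit_functions_def domC_def imC_def mem_Collect_eq
      ideal_code_subset_length_iff[OF right_ideal_dom[OF f]]
      ideal_code_subset_length_iff[OF right_ideal_ran[OF f]] by blast
qed

section \<open>Generated functions belong to the monoid\<close>

lemma gates_pflRM: "circuit_gates \<subseteq> pflRM"
proof -
  have "zeta1 \<in> pflRM"
    by (rule pflRMI[of _ 2 1]) (auto elim!: zeta1.elims)
  moreover have "not_gate \<in> pflRM"
    by (rule pflRMI[of _ 1 1]) (auto elim!: not_gate.elims)
  moreover have "and_gate \<in> pflRM"
    by (rule pflRMI[of _ 2 1]) (auto elim!: and_gate.elims)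
  moreover have "or_gate \<in> pflRM"
    by (rule pflRMI[of _ 2 1]) (auto elim!: or_gate.elims)
  moreover have "fork_gate \<in> pflRM"
    by (rule pflRMI[of _ 1 2]) (auto elim!: fork_gate.elims)
  ultimately show ?thesis by (simp add: circuit_gates_def)
qed

lemma taus_pflRM: "taus \<subseteq> pflRM"
proof -
  have "tau i j \<in> pflRM" if "1 \<le> i" "i < j" for i j
  proof (rule pflRMI[of _ j j])
    show "tau i j (x @ u) = Some (y @ u)" if "tau i j x = Some y" for x y u
      using that \<open>i < j\<close> by (auto simp: tau_def nth_append list_update_append split: if_splits)
  qed (auto simp: tau_def split: if_splits)
  then show ?thesis by (auto simp: taus_def)
qed

lemma generate_monoid_pflRM:
  assumes "S \<subseteq> pflRM" "f \<in> generate_monoid pflRM_monoid S"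
  shows "f \<in> pflRM"
  using assms(2)
proof induction
  case one
  then show ?case using monoid.one_closed[OF monoid_pflRM] by (simp add: pflRM_monoid_def)
next
  case (incl s)
  then show ?case using assms(1) by blast
next
  case (mult a b)
  then show ?case by (simp add: pflRM_monoid_def pflRM_comp)
qed

section \<open>Evaluating Boolean functions of the input\<close>

abbreviation generated_functions :: "(str \<rightharpoonup> str) set" where
  "generated_functions \<equiv> generate_monoid pflRM_monoid (circuit_gates \<union> taus)"

lemma generated_comp:
  "g \<in> generated_functions \<Longrightarrow> f \<in> generated_functions \<Longrightarrow> g \<circ>\<^sub>m f \<in> generated_functions"
  using generate_monoid.mult[of g pflRM_monoid _ f] by (simp add: pflRM_monoid_def)

lemma generated_gates:
  "zeta1 \<in> generated_functions" "not_gate \<in> generated_functions"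
  "and_gate \<in> generated_functions" "or_gate \<in> generated_functions"
  "fork_gate \<in> generated_functions"
  by (auto intro!: generate_monoid.incl simp: circuit_gates_def)

lemma generated_tau: "1 \<le> i \<Longrightarrow> i < j \<Longrightarrow> tau i j \<in> generated_functions"
  by (auto intro!: generate_monoid.incl simp: taus_def)

definition id_from :: "nat \<Rightarrow> str \<rightharpoonup> str" where
  "id_from m x = (if m \<le> length x then Some x else None)"

text \<open>An involution that reads the first \<open>m\<close> bits, applied twice, does nothing but insist on their
  presence.\<close>

lemma id_from_generated:
  assumes "m \<ge> 1"
  shows "id_from m \<in> generated_functions"
proof (cases "m = 1")
  case True
  have "id_from 1 x = (not_gate \<circ>\<^sub>m not_gate) x" for x
    by (cases x) (auto simp: id_from_def)
  then have "id_from 1 = not_gate \<circ>\<^sub>m not_gate" by blast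
  then show ?thesis using True generated_comp[OF generated_gates(2) generated_gates(2)] by simp
next
  case False
  then have "m = Suc (Suc (m - 2))" using assms by simp
  then obtain k where m: "m = Suc (Suc k)" by blast
  have "id_from m x = (tau 1 m \<circ>\<^sub>m tau 1 m) x" for x
    using m by (cases x) (auto simp: id_from_def tau_def)
  then have "id_from m = tau 1 m \<circ>\<^sub>m tau 1 m" by blast
  then show ?thesis using generated_comp[OF generated_tau generated_tau] m by simp
qed

definition adjoin_bit :: "nat \<Rightarrow> (str \<Rightarrow> bool) \<Rightarrow> str \<rightharpoonup> str" where
  "adjoin_bit m b x = (if m \<le> length x then Some (b (take m x) # x) else None)"

text \<open>The input of \<open>b\<close> stands behind \<open>s\<close> bits already computed. All displacements \<open>s\<close> are demanded
  at once, because the second argument of a binary gate is evaluated when the value of the first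
  argument already stands in front of the input.\<close>

definition computable :: "nat \<Rightarrow> (str \<Rightarrow> bool) \<Rightarrow> bool" where
  "computable m b \<longleftrightarrow> (\<forall>s. adjoin_bit (s + m) (\<lambda>x. b (drop s x)) \<in> generated_functions)"

lemma computable_cong:
  assumes "computable m b" "\<And>x. length x = m \<Longrightarrow> b x = c x"
  shows "computable m c"
proof -
  have "adjoin_bit (s + m) (\<lambda>x. c (drop s x)) = adjoin_bit (s + m) (\<lambda>x. b (drop s x))" for s
    using assms(2) by (auto simp: adjoin_bit_def fun_eq_iff)
  then show ?thesis using assms(1) by (simp add: computable_def)
qed

text \<open>To copy the bit at position \<open>i\<close>, exchange it with the first one, fork, and undo the exchange
  one position further to the right.\<close>

lemma adjoin_copy_generated:
  assumes "i < m"
  shows "adjoin_bit m (\<lambda>x. x ! i) \<in> generated_functions"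
proof (cases i)
  case 0
  have "adjoin_bit m (\<lambda>x. x ! i) x = (fork_gate \<circ>\<^sub>m id_from m) x" for x
    using assms 0 by (cases x) (auto simp: adjoin_bit_def id_from_def)
  then have "adjoin_bit m (\<lambda>x. x ! i) = fork_gate \<circ>\<^sub>m id_from m" by blast
  then show ?thesis
    using generated_comp[OF generated_gates(5) id_from_generated] assms by simp
next
  case (Suc k)
  have "adjoin_bit m (\<lambda>x. x ! i) x
      = (tau 2 (k + 3) \<circ>\<^sub>m (fork_gate \<circ>\<^sub>m (tau 1 (k + 2) \<circ>\<^sub>m id_from m))) x" for x
    using assms Suc
    by (cases x) (auto simp: adjoin_bit_def id_from_def tau_def numeral_2_eq_2 numeral_3_eq_3)
  then have "adjoin_bit m (\<lambda>x. x ! i)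
      = tau 2 (k + 3) \<circ>\<^sub>m (fork_gate \<circ>\<^sub>m (tau 1 (k + 2) \<circ>\<^sub>m id_from m))" by blast
  then show ?thesis
    using assms by (simp add: generated_comp generated_gates generated_tau id_from_generated)
qed

lemma computable_nth:
  assumes "i < m"
  shows "computable m (\<lambda>x. x ! i)"
  unfolding computable_def
proof
  fix s
  have "adjoin_bit (s + m) (\<lambda>x. drop s x ! i) = adjoin_bit (s + m) (\<lambda>x. x ! (s + i))"
    by (auto simp: adjoin_bit_def fun_eq_iff)
  then show "adjoin_bit (s + m) (\<lambda>x. drop s x ! i) \<in> generated_functions"
    using adjoin_copy_generated[of "s + i" "s + m"] assms by simp
qed

lemma computable_not:
  assumes "computable m b"
  shows "computable m (\<lambda>x. \<not> b x)"
  unfolding computable_def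
proof
  fix s
  have "adjoin_bit (s + m) (\<lambda>x. \<not> b (drop s x))
      = not_gate \<circ>\<^sub>m adjoin_bit (s + m) (\<lambda>x. b (drop s x))"
    by (auto simp: adjoin_bit_def map_comp_def fun_eq_iff)
  then show "adjoin_bit (s + m) (\<lambda>x. \<not> b (drop s x)) \<in> generated_functions"
    using generated_comp[OF generated_gates(2)] assms by (simp add: computable_def)
qed

lemma computable_binary_gate:
  assumes g: "g \<in> generated_functions" "\<And>p q v. g (p # q # v) = Some (h p q # v)"
    and b: "computable m b" and c: "computable m c"
  shows "computable m (\<lambda>x. h (c x) (b x))"
  unfolding computable_def
proof
  fix s
  have "adjoin_bit (s + m) (\<lambda>x. h (c (drop s x)) (b (drop s x)))
      = g \<circ>\<^sub>m (adjoin_bit (Suc s + m) (\<lambda>x. c (drop (Suc s) x))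
            \<circ>\<^sub>m adjoin_bit (s + m) (\<lambda>x. b (drop s x)))"
    using g(2) by (auto simp: adjoin_bit_def map_comp_def fun_eq_iff)
  moreover have "adjoin_bit (Suc s + m) (\<lambda>x. c (drop (Suc s) x)) \<in> generated_functions"
    using c unfolding computable_def by blast
  moreover have "adjoin_bit (s + m) (\<lambda>x. b (drop s x)) \<in> generated_functions"
    using b unfolding computable_def by blast
  ultimately show "adjoin_bit (s + m) (\<lambda>x. h (c (drop s x)) (b (drop s x))) \<in> generated_functions"
    using g(1) by (simp only: generated_comp)
qed

lemma computable_and: "computable m b \<Longrightarrow> computable m c \<Longrightarrow> computable m (\<lambda>x. b x \<and> c x)"
  using computable_binary_gate[OF generated_gates(3), of "(\<and>)"] by simp

lemma computable_or: "computable m b \<Longrightarrow> computable m c \<Longrightarrow> computable m (\<lambda>x. b x \<or> c x)"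
  using computable_binary_gate[OF generated_gates(4), of "(\<or>)"] by simp

text \<open>Shannon expansion along the last relevant bit: for each of its two values, a function of one
  bit fewer remains. The constants at the bottom of the recursion are \<open>x\<^sub>1 \<or> \<not> x\<^sub>1\<close> and its negation,
  so at least one input bit is needed.\<close>

lemma computable_of_take:
  assumes "m \<ge> 1" "j \<le> m"
  shows "computable m (\<lambda>x. b (take j x))"
  using assms(2)
proof (induction j arbitrary: b)
  case 0
  have first: "computable m (\<lambda>x. x ! 0)" using computable_nth[of 0 m] assms(1) by simp
  have true: "computable m (\<lambda>x. True)"
    by (rule computable_cong[OF computable_or[OF first computable_not[OF first]]]) simp
  show ?case using true computable_not[OF true] by (cases "b []") auto
next
  case (Suc j)
  have bit: "computable m (\<lambda>x. x ! j)" using computable_nth Suc.prems by simp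
  have "computable m (\<lambda>x. b (take j x @ [v]))" for v
    using Suc.IH[of "\<lambda>y. b (y @ [v])"] Suc.prems by simp
  then have "computable m (\<lambda>x. x ! j \<and> b (take j x @ [True]) \<or> \<not> x ! j \<and> b (take j x @ [False]))"
    by (intro computable_or computable_and computable_not bit)
  then show ?case
  proof (rule computable_cong)
    fix x :: str
    assume "length x = m"
    then have "take (Suc j) x = take j x @ [x ! j]" using Suc.prems by (simp add: take_Suc_conv_app_nth)
    then show "(x ! j \<and> b (take j x @ [True]) \<or> \<not> x ! j \<and> b (take j x @ [False]))
        = b (take (Suc j) x)"
      by (cases "x ! j") auto
  qed
qed

lemma computable_any:
  assumes "m \<ge> 1"
  shows "computable m b"
  by (rule computable_cong[OF computable_of_take[OF assms order_refl, of b]]) simp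

text \<open>The bits of \<open>T x\<close> are produced from the last to the first.\<close>

lemma adjoin_string_generated:
  assumes "m \<ge> 1" "\<And>x. length x = m \<Longrightarrow> length (T x) = n"
  shows "(\<lambda>x. if m \<le> length x then Some (T (take m x) @ x) else None) \<in> generated_functions"
  using assms(2)
proof (induction n arbitrary: T)
  case 0
  then have "(\<lambda>x. if m \<le> length x then Some (T (take m x) @ x) else None) = id_from m"
    by (auto simp: id_from_def fun_eq_iff)
  then show ?case using id_from_generated[OF assms(1)] by simp
next
  case (Suc n)
  let ?W = "\<lambda>x. if m \<le> length x then Some (tl (T (take m x)) @ x) else None"
  let ?K = "adjoin_bit (n + m) (\<lambda>x. hd (T (drop n x)))"
  have "(if m \<le> length x then Some (T (take m x) @ x) else None) = (?K \<circ>\<^sub>m ?W) x" for x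
  proof (cases "m \<le> length x")
    case True
    then have "length (T (take m x)) = Suc n" using Suc.prems by simp
    then obtain c y where "T (take m x) = c # y" "length y = n" by (auto simp: length_Suc_conv)
    then show ?thesis using True by (simp add: adjoin_bit_def)
  qed simp
  moreover have "?W \<in> generated_functions"
    using Suc.IH[of "\<lambda>x. tl (T x)"] Suc.prems by simp
  moreover have "?K \<in> generated_functions"
    using computable_any[OF assms(1), of "\<lambda>x. hd (T x)"] unfolding computable_def by blast
  ultimately show ?case using generated_comp[of ?K ?W] by presburger
qed

section \<open>Deleting bits\<close>

definition delete_block :: "nat \<Rightarrow> nat \<Rightarrow> str \<rightharpoonup> str" where
  "delete_block n j x = (if n + j \<le> length x then Some (take n x @ drop (n + j) x) else None)"

text \<open>The second bit is deleted by absorption into the first one, since \<open>(z \<or> y) \<and> y = y\<close>. A bit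
  further to the right is moved there by exchanging it with its left neighbours one after the other,
  which keeps the other bits in order.\<close>

lemma delete_bit_generated:
  assumes "n \<ge> 1"
  shows "delete_block n 1 \<in> generated_functions"
  using assms
proof (induction n rule: nat_induct_at_least)
  case base
  have "delete_block 1 1 x = (and_gate \<circ>\<^sub>m (or_gate \<circ>\<^sub>m (tau 1 3 \<circ>\<^sub>m fork_gate))) x" for x
  proof (cases x)
    case (Cons y w)
    then show ?thesis
      by (cases w) (auto simp: delete_block_def tau_def numeral_3_eq_3 numeral_2_eq_2)
  qed (simp add: delete_block_def)
  then have "delete_block 1 1 = and_gate \<circ>\<^sub>m (or_gate \<circ>\<^sub>m (tau 1 3 \<circ>\<^sub>m fork_gate))" by blast
  then show ?case by (simp add: generated_comp generated_gates generated_tau)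
next
  case (Suc n)
  have "delete_block (Suc n) 1 x = (delete_block n 1 \<circ>\<^sub>m tau (Suc n) (Suc (Suc n))) x" for x
  proof (cases "Suc (Suc n) \<le> length x")
    case True
    then have "x = take n x @ x ! n # x ! Suc n # drop (Suc (Suc n)) x"
      by (metis Cons_nth_drop_Suc Suc_leD append_take_drop_id Suc_le_eq)
    then obtain p y z w where x: "x = p @ y # z # w" "length p = n"
      using True by (metis Suc_leD length_take min.absorb2)
    then show ?thesis by (simp add: delete_block_def tau_def nth_append list_update_append)
  qed (simp add: delete_block_def tau_def)
  then have "delete_block (Suc n) 1 = delete_block n 1 \<circ>\<^sub>m tau (Suc n) (Suc (Suc n))" by blast
  then show ?case using generated_comp[OF Suc.IH generated_tau] by simp
qed

lemma delete_block_generated: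
  assumes "n \<ge> 1" "j \<ge> 1"
  shows "delete_block n j \<in> generated_functions"
  using assms(2)
proof (induction j rule: nat_induct_at_least)
  case base
  show ?case using delete_bit_generated[OF assms(1)] .
next
  case (Suc j)
  have "delete_block n (Suc j) x = (delete_block n 1 \<circ>\<^sub>m delete_block n j) x" for x
    by (auto simp: delete_block_def map_comp_def)
  then have "delete_block n (Suc j) = delete_block n 1 \<circ>\<^sub>m delete_block n j" by blast
  then show ?case using generated_comp[OF delete_bit_generated[OF assms(1)] Suc.IH] by simp
qed

lemma total_function_generated:
  assumes "m \<ge> 1" "n \<ge> 1" "\<And>x. length x = m \<Longrightarrow> length (T x) = n"
  shows "(\<lambda>x. if m \<le> length x then Some (T (take m x) @ drop m x) else None)
      \<in> generated_functions"
proof -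
  have "(\<lambda>x. if m \<le> length x then Some (T (take m x) @ drop m x) else None)
      = delete_block n m \<circ>\<^sub>m (\<lambda>x. if m \<le> length x then Some (T (take m x) @ x) else None)"
    using assms(3) by (auto simp: delete_block_def map_comp_def fun_eq_iff)
  then show ?thesis
    using generated_comp[OF delete_block_generated[OF assms(2,1)] adjoin_string_generated[OF assms(1,3)]]
    by simp
qed

section \<open>The functions generated by the gates\<close>

text \<open>The total function computed first delivers a leading error bit, which is 1 where the partial
  function is undefined; \<^const>\<open>zeta1\<close> accepts only the error bit 0 and removes it.\<close>

lemma circuit_function_generated:
  assumes "f \<in> circuit_functions"
  shows "f \<in> generated_functions"
proof -
  have f: "f \<in> pflRM" and nil: "[] \<notin> dom f" "[] \<notin> ran f"
    using assms by (auto simp: circuit_functions_iff)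
  obtain m n where mn: "m \<ge> 1" "n \<ge> 1"
    and rew: "\<And>x y. f x = Some y \<Longrightarrow>
      m \<le> length x \<and> (\<exists>z. f (take m x) = Some z \<and> length z = n \<and> y = z @ drop m x)"
  proof (cases "f = Map.empty")
    case True
    then show ?thesis using that[of 1 1] by simp
  next
    case False
    obtain m n where
      rew: "\<And>x y. f x = Some y \<Longrightarrow>
        m \<le> length x \<and> (\<exists>z. f (take m x) = Some z \<and> length z = n \<and> y = z @ drop m x)"
      and ex: "\<exists>x y. f x = Some y \<and> length x = m \<and> length y = n"
      using pflRM_prefix_rewriting[OF f False] by blast
    from ex obtain x0 y0 where x0: "f x0 = Some y0" "length x0 = m" "length y0 = n" by blast
    then have "x0 \<noteq> []" "y0 \<noteq> []" using nil by (auto simp: ran_def)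
    then have "m \<ge> 1" "n \<ge> 1" using x0 by (auto simp: Suc_le_eq)
    then show ?thesis using that rew by blast
  qed
  define T where "T x = (case f x of None \<Rightarrow> True # replicate n False | Some y \<Rightarrow> False # y)" for x
  have T: "length (T x) = Suc n" if x: "length x = m" for x
  proof (cases "f x")
    case (Some y)
    then have "length y = n" using rew[OF Some] x by auto
    then show ?thesis using Some by (simp add: T_def)
  qed (simp add: T_def)
  let ?t = "\<lambda>x. if m \<le> length x then Some (T (take m x) @ drop m x) else None"
  have "f x = (zeta1 \<circ>\<^sub>m ?t) x" for x
  proof (cases "m \<le> length x")
    case True
    show ?thesis
    proof (cases "f (take m x)")
      case None
      have "f x = None" using rew[of x] None by (cases "f x") auto
      then show ?thesis using True None by (simp add: T_def)
    next
      case (Some z)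
      have "length z = n" using rew[OF Some] True by simp
      then obtain c w where "z = c # w" using mn by (cases z) auto
      moreover have "f x = Some (z @ drop m x)"
        using pflRM_extend[OF f Some, of "drop m x"] by simp
      ultimately show ?thesis using True Some by (simp add: T_def)
    qed
  next
    case False
    then show ?thesis using rew[of x] by (cases "f x") auto
  qed
  then have "f = zeta1 \<circ>\<^sub>m ?t" by blast
  moreover have "?t \<in> generated_functions"
    using total_function_generated[OF mn(1) _ T] by simp
  ultimately show ?thesis using generated_comp[OF generated_gates(1), of ?t] by simp
qed

theorem generated_functions_eq: "generated_functions = insert Some circuit_functions"
proof (intro equalityI subsetI)
  fix f assume f: "f \<in> generated_functions"
  then have "f \<in> pflRM" using generate_monoid_pflRM gates_pflRM taus_pflRM by blast
  then show "f \<in> insert Some circuit_functions"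
    using generate_circuit_gates_nil[OF f] by (auto simp: circuit_functions_iff)
next
  fix f assume "f \<in> insert Some circuit_functions"
  then show "f \<in> generated_functions"
    using circuit_function_generated
      generate_monoid.one[of pflRM_monoid "circuit_gates \<union> taus"] by (auto simp: pflRM_monoid_def)
qed

section \<open>A finite generating set up to bit transpositions\<close>

definition push_gate :: "str \<rightharpoonup> str" where
  "push_gate v = Some (False # v)"

fun pop_gate :: "str \<rightharpoonup> str" where
  "pop_gate (x # v) = Some v"
| "pop_gate [] = None"

fun under_first_bit :: "(str \<rightharpoonup> str) \<Rightarrow> str \<rightharpoonup> str" where
  "under_first_bit f (b # v) = map_option (Cons False) (f v)"
| "under_first_bit f [] = None"

lemma push_pop_pflRM: "push_gate \<in> pflRM" "pop_gate \<in> pflRM"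
proof -
  show "push_gate \<in> pflRM"
    by (rule pflRMI[of _ 0 1]) (auto simp: push_gate_def)
  show "pop_gate \<in> pflRM"
    by (rule pflRMI[of _ 1 0]) (auto elim!: pop_gate.elims)
qed

lemma under_first_bit_circuit_function:
  assumes f: "f \<in> pflRM"
  shows "under_first_bit f \<in> circuit_functions"
proof -
  have "under_first_bit f \<in> pflRM"
  proof (cases "f = Map.empty")
    case True
    then show ?thesis by (intro pflRMI[of _ 0 0]) (auto elim!: under_first_bit.elims)
  next
    case False
    obtain m n where rew: "\<And>x y. f x = Some y \<Longrightarrow>
        m \<le> length x \<and> (\<exists>z. f (take m x) = Some z \<and> length z = n \<and> y = z @ drop m x)"
      using pflRM_prefix_rewriting[OF f False] by blast
    show ?thesis
    proof (rule pflRMI[of _ "Suc m" "Suc n"])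
      fix x y u assume "under_first_bit f x = Some y"
      then show "under_first_bit f (x @ u) = Some (y @ u)"
        using pflRM_extend[OF f] by (cases x) auto
    next
      fix x y assume "under_first_bit f x = Some y"
      then show "Suc m \<le> length x \<and> under_first_bit f (take (Suc m) x) \<noteq> None"
        using rew by (cases x) fastforce+
    next
      fix x y assume "under_first_bit f x = Some y"
      then show "length y + Suc m = length x + Suc n"
        using rew by (cases x) fastforce+
    qed
  qed
  moreover have "[] \<notin> dom (under_first_bit f)" by auto
  moreover have "under_first_bit f x \<noteq> Some []" for x by (cases x) auto
  then have "[] \<notin> ran (under_first_bit f)" by (auto simp: ran_def)
  ultimately show ?thesis by (simp add: circuit_functions_iff)
qed

lemma generate_monoid_mono:
  assumes "S \<subseteq> S'" "f \<in> generate_monoid G S"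
  shows "f \<in> generate_monoid G S'"
  using assms(2)
  by induction (use assms(1) in \<open>auto intro: generate_monoid.intros\<close>)

text \<open>The auxiliary first bit makes both code lengths positive, whatever they were before.\<close>

lemma gates_push_pop_generate:
  "generate_monoid pflRM_monoid (insert push_gate (insert pop_gate circuit_gates) \<union> taus)
     = carrier pflRM_monoid"
  (is "generate_monoid _ ?S = _")
proof (intro equalityI subsetI)
  fix f assume f: "f \<in> generate_monoid pflRM_monoid ?S"
  have "?S \<subseteq> pflRM" using gates_pflRM taus_pflRM push_pop_pflRM by auto
  then show "f \<in> carrier pflRM_monoid"
    using generate_monoid_pflRM[OF _ f] by (simp add: pflRM_monoid_def)
next
  fix f assume "f \<in> carrier pflRM_monoid"
  then have "under_first_bit f \<in> generated_functions"
    using under_first_bit_circuit_function circuit_function_generated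
    by (simp add: pflRM_monoid_def)
  then have "under_first_bit f \<in> generate_monoid pflRM_monoid ?S"
    by (rule generate_monoid_mono[rotated]) auto
  moreover have "push_gate \<in> generate_monoid pflRM_monoid ?S"
    "pop_gate \<in> generate_monoid pflRM_monoid ?S"
    by (auto intro: generate_monoid.incl)
  ultimately have "pop_gate \<circ>\<^sub>m (under_first_bit f \<circ>\<^sub>m push_gate) \<in> generate_monoid pflRM_monoid ?S"
    using generate_monoid.mult[of _ pflRM_monoid ?S] by (simp add: pflRM_monoid_def)
  moreover have "f v = (pop_gate \<circ>\<^sub>m (under_first_bit f \<circ>\<^sub>m push_gate)) v" for v
    by (cases "f v") (simp_all add: push_gate_def)
  then have "f = pop_gate \<circ>\<^sub>m (under_first_bit f \<circ>\<^sub>m push_gate)" by blast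
  ultimately show "f \<in> generate_monoid pflRM_monoid ?S" by simp
qed

theorem proposition3p10:
  shows "(\<exists>\<Gamma>. finite \<Gamma> \<and> \<Gamma> \<subseteq> pflRM \<and>
              generate_monoid pflRM_monoid (\<Gamma> \<union> taus) = carrier pflRM_monoid) \<and>
         generate_monoid pflRM_monoid (circuit_gates \<union> taus) = insert Some circuit_functions"
proof (intro conjI exI)
  show "finite (insert push_gate (insert pop_gate circuit_gates))"
    by (simp add: circuit_gates_def)
  show "insert push_gate (insert pop_gate circuit_gates) \<subseteq> pflRM"
    using gates_pflRM push_pop_pflRM by simp
qed (fact gates_push_pop_generate generated_functions_eq)+

end
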